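(* Let $X$ be a compact Hausdorff $F$-space. Then $X$ is hereditarily indecomposable if and only if $X$ satisfies the Intermediate Value Theorem for completely factored polynomials, that is, if and only if the following holds: for every integer $n\ge 1$, all $f_1,\dots,f_n\in C(X)$ and all $u,v\in C(X)$, if the polynomial $p(t)=\prod_{i=1}^n(t-f_i)$ satisfies $p(u)\le \mathbf{0}\le p(v)$, then there is $w\in C(X)$ such that $u\wedge v\le w\le u\vee v$ and $p(w)=\mathbf{0}$.
   Context: $C(X)$ denotes the ring of continuous real-valued functions on $X$ (for compact $X$ it equals the ring $C^*(X)$ of bounded ones), with pointwise operations and pointwise order; $\mathbf{0}$ and $\mathbf{1}$ denote the constant functions with values $0$ and $1$; $u\wedge v$ and $u\vee v$ denote the pointwise minimum and maximum of $u$ and $v$; $p(u)$ denotes the function $x\mapsto \prod_{i=1}^n\bigl(u(x)-f_i(x)\bigr)$. A compact Hausdorff space $X$ is an $F$-space if for every $f\in C(X)$ there is $w\in C(X)$ with $-\mathbf{1}\le w\le\mathbf{1}$ and $f=w\,|f|$ (equivalently, disjoint cozero sets of $X$ have disjoint closures). A continuum is a nonempty compact connected Hausdorff space. A continuum is indecomposable if it cannot be written as the union of two proper subcontinua. A compact Hausdorff space $X$ (connected or not) is called hereditarily indecomposable if every nonempty closed connected subspace of $X$ is indecomposable; in particular, compact zero-dimensional spaces are hereditarily indecomposable. *)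

theory Defs
  imports "HOL-Analysis.Analysis"
begin

text \<open>
  Spaces are abstract topologies. An element of \<open>C(X)\<close> is represented by a total function \<open>f\<close> with
  \<open>continuous_map X euclideanreal f\<close>; its values outside \<open>topspace X\<close> are irrelevant, so all
  identities and inequalities in \<open>C(X)\<close> are stated pointwise on \<open>topspace X\<close>.
\<close>

text \<open>The compactness and Hausdorff hypotheses are imposed separately, where the notion is used.\<close>

definition F_space :: "'a topology \<Rightarrow> bool" where
  "F_space X \<longleftrightarrow>
     (\<forall>f. continuous_map X euclideanreal f \<longrightarrow>
        (\<exists>w. continuous_map X euclideanreal w \<and>
             (\<forall>x\<in>topspace X. -1 \<le> w x \<and> w x \<le> 1) \<and>
             (\<forall>x\<in>topspace X. f x = w x * \<bar>f x\<bar>)))"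

definition continuum :: "'a topology \<Rightarrow> bool" where
  "continuum X \<longleftrightarrow>
     topspace X \<noteq> {} \<and> compact_space X \<and> connected_space X \<and> Hausdorff_space X"

definition proper_subcontinuum :: "'a topology \<Rightarrow> 'a set \<Rightarrow> bool" where
  "proper_subcontinuum X A \<longleftrightarrow> A \<subset> topspace X \<and> continuum (subtopology X A)"

definition indecomposable_continuum :: "'a topology \<Rightarrow> bool" where
  "indecomposable_continuum X \<longleftrightarrow>
     continuum X \<and>
     \<not> (\<exists>A B. proper_subcontinuum X A \<and> proper_subcontinuum X B \<and> topspace X = A \<union> B)"

definition hereditarily_indecomposable :: "'a topology \<Rightarrow> bool" where
  "hereditarily_indecomposable X \<longleftrightarrow>
     (\<forall>K. K \<noteq> {} \<and> closedin X K \<and> connectedin X K \<longrightarrow>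
          indecomposable_continuum (subtopology X K))"

text \<open>The value \<open>p(u)\<close> of the polynomial \<open>p(t) = (t - f\<^sub>1) \<cdots> (t - f\<^sub>n)\<close> at the function \<open>u\<close>.\<close>

definition factored_poly ::
  "nat \<Rightarrow> (nat \<Rightarrow> 'a \<Rightarrow> real) \<Rightarrow> ('a \<Rightarrow> real) \<Rightarrow> 'a \<Rightarrow> real" where
  "factored_poly n f u = (\<lambda>x. \<Prod>i=1..n. (u x - f i x))"

definition IVT_completely_factored :: "'a topology \<Rightarrow> bool" where
  "IVT_completely_factored X \<longleftrightarrow>
     (\<forall>n\<ge>1. \<forall>f u v.
        (\<forall>i\<in>{1..n}. continuous_map X euclideanreal (f i)) \<and>
        continuous_map X euclideanreal u \<and>
        continuous_map X euclideanreal v \<and>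
        (\<forall>x\<in>topspace X. factored_poly n f u x \<le> 0 \<and> 0 \<le> factored_poly n f v x) \<longrightarrow>
        (\<exists>w. continuous_map X euclideanreal w \<and>
             (\<forall>x\<in>topspace X. min (u x) (v x) \<le> w x \<and> w x \<le> max (u x) (v x)) \<and>
             (\<forall>x\<in>topspace X. factored_poly n f w x = 0)))"

end

theory Submission
  imports Defs
begin

text \<open>
  Indecomposability to IVT: the heart is a cubic with ordered roots \<open>a \<le> b \<le> c\<close> and \<open>u \<le> v\<close>.
  One starts from \<open>w = b\<close>, which must be lowered to \<open>a\<close> where \<open>v < b\<close> and raised to \<open>c\<close> where
  \<open>u > b\<close>. Changing from \<open>b\<close> to \<open>a\<close> is continuous on a relatively clopen part \<open>H\<close> of the closure
  of \<open>G = {a < b, u < b}\<close>, and similarly for \<open>c\<close> on a clopen part \<open>J\<close> of the closure of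
  \<open>E = {b < c, b < v}\<close>. In an \<open>F\<close>-space the closures of \<open>{v < b}\<close> and \<open>E\<close> are disjoint, and so are
  those of \<open>{u > b}\<close> and \<open>G\<close>. Hence a component of the closure of \<open>G\<close> meeting the first set and a
  component of the closure of \<open>E\<close> meeting the second are not nested, so by hereditary
  indecomposability they are disjoint; by compactness \<open>H\<close> and \<open>J\<close> can be chosen disjoint.
  For higher degree, the cubic case replaces the three largest roots by a single one, lowering the
  degree by two.
\<close>

section \<open>Closed subspaces\<close>

text \<open>Compact Hausdorff spaces are normal, so Tietze extends \<open>f\<close> to a function on
  \<open>X\<close>, whose sign factor restricts to one for \<open>f\<close>.\<close>

lemma F_space_subtopology:
  assumes X: "compact_space X" "Hausdorff_space X" and F: "F_space X" and S: "closedin X S"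
  shows "F_space (subtopology X S)"
  unfolding F_space_def
proof (intro allI impI)
  fix f assume f: "continuous_map (subtopology X S) euclideanreal f"
  have "normal_space X"
    using X by (simp add: compact_Hausdorff_or_regular_imp_normal_space)
  then obtain g where g: "continuous_map X euclideanreal g" "\<And>x. x \<in> S \<Longrightarrow> g x = f x"
    using Tietze_extension_realinterval[of X S UNIV f] S f by auto
  obtain w where w: "continuous_map X euclideanreal w"
      "\<forall>x\<in>topspace X. -1 \<le> w x \<and> w x \<le> 1" "\<forall>x\<in>topspace X. g x = w x * \<bar>g x\<bar>"
    using F[unfolded F_space_def, rule_format, OF g(1)] by blast
  have "f x = w x * \<bar>f x\<bar>" if "x \<in> topspace X" "x \<in> S" for x
    using w(3)[rule_format, OF that(1)] unfolding g(2)[OF that(2)] .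
  moreover have "continuous_map (subtopology X S) euclideanreal w"
    using w(1) by (rule continuous_map_from_subtopology)
  ultimately show "\<exists>w. continuous_map (subtopology X S) euclideanreal w \<and>
      (\<forall>x\<in>topspace (subtopology X S). -1 \<le> w x \<and> w x \<le> 1) \<and>
      (\<forall>x\<in>topspace (subtopology X S). f x = w x * \<bar>f x\<bar>)"
    using w(2) by (intro exI[of _ w] conjI ballI) (simp_all only: topspace_subtopology Int_iff)
qed

lemma hereditarily_indecomposable_subtopology:
  assumes "hereditarily_indecomposable X" and S: "closedin X S"
  shows "hereditarily_indecomposable (subtopology X S)"
  unfolding hereditarily_indecomposable_def
proof (intro allI impI)
  fix K assume K: "K \<noteq> {} \<and> closedin (subtopology X S) K \<and> connectedin (subtopology X S) K"
  then have "K \<subseteq> S" "closedin X K" "connectedin X K"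
    using S by (auto simp: connectedin_subtopology dest: closedin_trans_full)
  with assms K show "indecomposable_continuum (subtopology (subtopology X S) K)"
    unfolding hereditarily_indecomposable_def
    by (simp add: subtopology_subtopology inf.absorb2)
qed

lemma continuum_subtopology:
  assumes "compact_space X" "Hausdorff_space X" "closedin X K" "connectedin X K" "K \<noteq> {}"
  shows "continuum (subtopology X K)"
proof -
  have "K \<subseteq> topspace X" "compactin X K"
    using assms by (auto simp: closedin_subset closedin_compact_space)
  then show ?thesis
    using assms Hausdorff_space_subtopology[of X K] compact_space_subtopology[of X K]
    by (simp add: continuum_def connectedin_def Int_absorb1)
qed

section \<open>Separation in hereditarily indecomposable spaces\<close>

text \<open>Otherwise the continuum \<open>P \<union> Q\<close> would be decomposed by its proper
  subcontinua \<open>P\<close> and \<open>Q\<close>.\<close>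

lemma hereditarily_indecomposable_nested:
  assumes X: "compact_space X" "Hausdorff_space X" and HI: "hereditarily_indecomposable X"
    and P: "closedin X P" "connectedin X P" and Q: "closedin X Q" "connectedin X Q"
    and ne: "P \<inter> Q \<noteq> {}"
  shows "P \<subseteq> Q \<or> Q \<subseteq> P"
proof (rule ccontr)
  assume neg: "\<not> ?thesis"
  let ?K = "P \<union> Q" 
  have sub: "P \<subseteq> topspace X" "Q \<subseteq> topspace X"
    using P Q by (auto dest: closedin_subset)
  have "indecomposable_continuum (subtopology X ?K)"
    using HI[unfolded hereditarily_indecomposable_def, rule_format, of ?K]
      closedin_Un[OF P(1) Q(1)] connectedin_Un[OF P(2) Q(2) ne] ne by auto
  moreover have "proper_subcontinuum (subtopology X ?K) P" "proper_subcontinuum (subtopology X ?K) Q"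
    using neg sub ne continuum_subtopology[OF X P] continuum_subtopology[OF X Q]
    by (auto simp: proper_subcontinuum_def subtopology_subtopology Int_absorb1)
  moreover have "topspace (subtopology X ?K) = P \<union> Q"
    using sub by auto
  ultimately show False
    unfolding indecomposable_continuum_def by blast
qed

text \<open>In a compact Hausdorff space, closed sets that no clopen set separates are joined by a
  connected set (cut wire fence theorem). The closure of such a set stays in the closed set
  \<open>K\<close>.\<close>

lemma not_separated_connection:
  assumes X: "compact_space X" "Hausdorff_space X" and K: "closedin X K"
    and A: "closedin X A" "A \<subseteq> K" and x: "x \<in> K"
    and meet: "\<And>H. closedin (subtopology X K) H \<Longrightarrow> openin (subtopology X K) H \<Longrightarrow> A \<subseteq> H \<Longrightarrow> x \<in> H"
  obtains P where "closedin X P" "connectedin X P" "x \<in> P" "P \<inter> A \<noteq> {}" "P \<subseteq> K"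
proof -
  let ?K = "subtopology X K"
  have sub: "K \<subseteq> topspace X"
    using K by (rule closedin_subset)
  have "\<not> separated_between ?K A {x}"
    using meet unfolding separated_between by blast
  moreover have "compact_space ?K" "Hausdorff_space ?K"
    using X K by (auto simp: Hausdorff_space_subtopology closedin_compact_space compact_space_subtopology)
  moreover have "closedin ?K A"
    using A by (simp add: closedin_subset_topspace)
  moreover have "closedin ?K {x}"
    using X(2) x sub by (simp add: closedin_Hausdorff_singleton Hausdorff_space_subtopology subset_iff)
  ultimately obtain C where C: "connectedin ?K C" "C \<inter> A \<noteq> {}" "x \<in> C"
    using cut_wire_fence_theorem[of ?K A "{x}"] by (auto simp: disjnt_def)
  then have "connectedin X C" "C \<subseteq> K"
    by (auto simp: connectedin_subtopology)
  moreover then have "C \<subseteq> X closure_of C" "X closure_of C \<subseteq> K"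
    using sub closure_of_subset[of C X] closure_of_minimal[of C K X] K by auto
  ultimately show thesis
    using that[of "X closure_of C"] C by (auto simp: connectedin_closure_of)
qed

text \<open>If all candidates \<open>H\<close> and \<open>J\<close> met, compactness would give a
  point \<open>x\<close> common to all of them. Continua \<open>P\<close> in \<open>K\<close> and
  \<open>Q\<close> in \<open>L\<close> would join \<open>x\<close> to \<open>A\<close> and to
  \<open>B\<close>. They share \<open>x\<close>, so they are nested; but
  \<open>P \<subseteq> Q\<close> puts a point of \<open>A\<close> into \<open>L\<close>, and
  \<open>Q \<subseteq> P\<close> a point of \<open>B\<close> into \<open>K\<close>.\<close>

lemma hereditarily_indecomposable_separation:
  assumes X: "compact_space X" "Hausdorff_space X" and HI: "hereditarily_indecomposable X"
    and K: "closedin X K" "closedin X L"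
    and A: "closedin X A" "A \<subseteq> K" "A \<inter> L = {}"
    and B: "closedin X B" "B \<subseteq> L" "B \<inter> K = {}"
  obtains H J where
    "closedin (subtopology X K) H" "openin (subtopology X K) H" "A \<subseteq> H"
    "closedin (subtopology X L) J" "openin (subtopology X L) J" "B \<subseteq> J" "H \<inter> J = {}"
proof -
  define \<H> where "\<H> = {H. closedin (subtopology X K) H \<and> openin (subtopology X K) H \<and> A \<subseteq> H}"
  define \<J> where "\<J> = {J. closedin (subtopology X L) J \<and> openin (subtopology X L) J \<and> B \<subseteq> J}"
  have K_in: "K \<in> \<H>" "L \<in> \<J>"
    using K A B closedin_topspace[of "subtopology X K"] openin_topspace[of "subtopology X K"]
      closedin_topspace[of "subtopology X L"] openin_topspace[of "subtopology X L"]
    by (auto simp: \<H>_def \<J>_def Int_absorb1 closedin_subset)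
  have Int_in: "G \<inter> H \<in> \<H>" if "G \<in> \<H>" "H \<in> \<H>" for G H
    using that by (auto simp: \<H>_def)
  have Int_in': "G \<inter> H \<in> \<J>" if "G \<in> \<J>" "H \<in> \<J>" for G H
    using that by (auto simp: \<J>_def)
  \<comment> \<open>Both families are closed under binary intersection, so the finite intersection
    property of their union reduces to single pairs \<open>H\<close>, \<open>J\<close>.\<close>
  have fin: "\<exists>H\<in>\<H>. \<exists>J\<in>\<J>. H \<inter> J \<subseteq> \<Inter>\<F>" if "finite \<F>" "\<F> \<subseteq> \<H> \<union> \<J>" for \<F>
    using that
  proof (induction \<F>)
    case empty
    then show ?case using K_in by auto
  next
    case (insert F \<F>)
    then obtain H J where HJ: "H \<in> \<H>" "J \<in> \<J>" "H \<inter> J \<subseteq> \<Inter>\<F>" by auto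
    from insert.prems consider "F \<in> \<H>" | "F \<in> \<J>" by auto
    then show ?case
    proof cases
      case 1
      then show ?thesis
        using HJ Int_in[of F H] by (intro bexI[of _ "F \<inter> H"] bexI[of _ J]) auto
    next
      case 2
      then show ?thesis
        using HJ Int_in'[of F J] by (intro bexI[of _ H] bexI[of _ "F \<inter> J"]) auto
    qed
  qed
  have "\<exists>H\<in>\<H>. \<exists>J\<in>\<J>. H \<inter> J = {}"
  proof (rule ccontr)
    assume neg: "\<not> ?thesis"
    have "closedin X C" if "C \<in> \<H> \<union> \<J>" for C
      using that K by (auto simp: \<H>_def \<J>_def dest: closedin_trans_full)
    moreover have "\<Inter>\<F> \<noteq> {}" if "finite \<F>" "\<F> \<subseteq> \<H> \<union> \<J>" for \<F>
      using fin[OF that] neg by fastforce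
    ultimately have "\<Inter>(\<H> \<union> \<J>) \<noteq> {}"
      using compact_space_fip[THEN iffD1, OF X(1), rule_format, of "\<H> \<union> \<J>"] by simp
    then obtain x where x: "\<And>H. H \<in> \<H> \<Longrightarrow> x \<in> H" "\<And>J. J \<in> \<J> \<Longrightarrow> x \<in> J" by auto
    have "x \<in> K" "x \<in> L"
      using x K_in by auto
    moreover have "x \<in> H" if "closedin (subtopology X K) H" "openin (subtopology X K) H" "A \<subseteq> H" for H
      using that x(1) by (simp add: \<H>_def)
    moreover have "x \<in> J" if "closedin (subtopology X L) J" "openin (subtopology X L) J" "B \<subseteq> J" for J
      using that x(2) by (simp add: \<J>_def)
    ultimately obtain P Q where
      P: "closedin X P" "connectedin X P" "x \<in> P" "P \<inter> A \<noteq> {}" "P \<subseteq> K" and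
      Q: "closedin X Q" "connectedin X Q" "x \<in> Q" "Q \<inter> B \<noteq> {}" "Q \<subseteq> L"
      using not_separated_connection[OF X K(1) A(1,2)] not_separated_connection[OF X K(2) B(1,2)]
      by metis
    have "P \<subseteq> Q \<or> Q \<subseteq> P"
      using hereditarily_indecomposable_nested[OF X HI P(1,2) Q(1,2)] P(3) Q(3) by blast
    then show False
      using P Q A B by blast
  qed
  then show thesis
    using that unfolding \<H>_def \<J>_def by blast
qed

section \<open>Disjoint closures and continuous truncation\<close>

text \<open>The sign factor of \<open>f - g\<close> is \<open>-1\<close> on the first set and
  \<open>1\<close> on the second, hence also on their closures.\<close>

lemma F_space_disjoint_closures:
  assumes F: "F_space X" and f: "continuous_map X euclideanreal f" and g: "continuous_map X euclideanreal g"
  shows "X closure_of {x \<in> topspace X. f x < g x} \<inter> X closure_of {x \<in> topspace X. g x < f x} = {}"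
proof -
  have "continuous_map X euclideanreal (\<lambda>x. f x - g x)"
    by (intro continuous_intros f g)
  from F[unfolded F_space_def, rule_format, OF this]
  obtain w where w: "continuous_map X euclideanreal w"
      and eq: "\<forall>x\<in>topspace X. f x - g x = w x * \<bar>f x - g x\<bar>"
    by blast
  have sgn: "w x = sgn (f x - g x)" if "x \<in> topspace X" "f x \<noteq> g x" for x
    using eq[rule_format, OF that(1)] that(2) sgn_mult_abs[of "f x - g x"]
    by (metis abs_eq_0_iff mult_right_cancel right_minus_eq)
  have cl: "closedin X {x \<in> topspace X. w x \<in> {c}}" for c
    using w by (rule closedin_continuous_map_preimage) simp
  have "X closure_of {x \<in> topspace X. f x < g x} \<subseteq> {x \<in> topspace X. w x \<in> {-1}}"
    using cl by (intro closure_of_minimal) (auto simp: sgn)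
  moreover have "X closure_of {x \<in> topspace X. g x < f x} \<subseteq> {x \<in> topspace X. w x \<in> {1}}"
    using cl by (intro closure_of_minimal) (auto simp: sgn)
  ultimately show ?thesis by fastforce
qed

lemma openin_less:
  assumes "continuous_map X euclideanreal f" "continuous_map X euclideanreal g"
  shows "openin X {x \<in> topspace X. f x < g x}"
proof -
  have "continuous_map X euclideanreal (\<lambda>x. g x - f x)"
    by (intro continuous_intros assms)
  from openin_continuous_map_preimage[OF this, of "{0<..}"] show ?thesis by simp
qed

lemma closedin_le:
  assumes "continuous_map X euclideanreal f" "continuous_map X euclideanreal g"
  shows "closedin X {x \<in> topspace X. f x \<le> g x}"
proof -
  have "continuous_map X euclideanreal (\<lambda>x. g x - f x)"
    by (intro continuous_intros assms)
  from closedin_continuous_map_preimage[OF this, of "{0..}"] show ?thesis by simp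
qed

lemma continuous_map_truncate:
  assumes S: "openin X S" and g: "continuous_map X euclideanreal g"
    and zero: "\<And>x. x \<in> X closure_of S \<Longrightarrow> x \<notin> S \<Longrightarrow> g x = 0"
  shows "continuous_map X euclideanreal (\<lambda>x. if x \<in> S then g x else (0::real))"
proof (rule continuous_map_cases)
  fix x assume "x \<in> X frontier_of {x. x \<in> S}"
  then show "g x = 0"
    using S zero by (auto simp: frontier_of_def interior_of_openin)
qed (auto intro: continuous_map_from_subtopology g)

text \<open>This is the correction that switches between the roots \<open>a\<close> and
  \<open>b\<close> on a clopen part. A limit point of \<open>G \<inter> H\<close> outside it lies in
  the closed set \<open>H\<close>, hence not in \<open>G\<close>; it also lies in \<open>M\<close>
  with \<open>a \<le> b\<close>, so \<open>a = b\<close> there and the correction fades out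
  continuously.\<close>

lemma clopen_part_truncate:
  assumes a: "continuous_map X euclideanreal a" and b: "continuous_map X euclideanreal b"
    and K: "openin X G" "closedin X M" "G = {x \<in> M. a x < b x}"
    and H: "closedin (subtopology X (X closure_of G)) H" "openin (subtopology X (X closure_of G)) H"
  shows "continuous_map X euclideanreal (\<lambda>x. if x \<in> G \<inter> H then b x - a x else 0)"
proof (rule continuous_map_truncate)
  have sub: "G \<subseteq> X closure_of G"
    using K(1) by (simp add: closure_of_subset openin_subset)
  obtain U where "openin X U" "H = U \<inter> X closure_of G"
    using H(2) by (auto simp: openin_subtopology)
  moreover have "G \<inter> H = G \<inter> U"
    using calculation sub by auto
  ultimately show "openin X (G \<inter> H)"
    using K(1) by auto
  show "continuous_map X euclideanreal (\<lambda>x. b x - a x)"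
    by (intro continuous_intros a b)
  fix x assume x: "x \<in> X closure_of (G \<inter> H)" "x \<notin> G \<inter> H"
  have "closedin X H"
    using H(1) closedin_closure_of closedin_trans_full by blast
  then have "X closure_of (G \<inter> H) \<subseteq> H"
    by (intro closure_of_minimal) auto
  then have "x \<notin> G" using x by auto
  have "closedin X {x \<in> topspace X. a x \<le> b x}"
    by (intro closedin_le a b)
  then have "closedin X (M \<inter> {x \<in> topspace X. a x \<le> b x})"
    using K(2) by auto
  then have "X closure_of (G \<inter> H) \<subseteq> M \<inter> {x \<in> topspace X. a x \<le> b x}"
    using K closedin_subset[OF K(2)] by (intro closure_of_minimal) auto
  then have "x \<in> M" "a x \<le> b x" using x by auto
  then show "b x - a x = 0" using \<open>x \<notin> G\<close> K(3) by auto
qed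

section \<open>The cubic case\<close>

lemma cubic_nonpos_cases:
  fixes a b c t :: real
  assumes "a \<le> b" "b \<le> c" "(t - a) * (t - b) * (t - c) \<le> 0"
  shows "t \<le> a \<or> b \<le> t \<and> t \<le> c"
proof (rule ccontr)
  assume "\<not> ?thesis"
  then consider "a < t" "t < b" "t < c" | "a < t" "b < t" "c < t" using assms by linarith
  then have "0 < (t - a) * (t - b) * (t - c)"
    by cases (auto simp: mult_pos_pos mult_pos_neg mult_neg_neg)
  then show False using assms by simp
qed

lemma cubic_nonneg_cases:
  fixes a b c t :: real
  assumes "a \<le> b" "b \<le> c" "0 \<le> (t - a) * (t - b) * (t - c)"
  shows "a \<le> t \<and> t \<le> b \<or> c \<le> t"
proof -
  \<comment> \<open>Negating everything reverses both the order of the roots and the sign of the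
    cubic.\<close>
  have "(- t - - c) * (- t - - b) * (- t - - a) \<le> 0"
    using assms(3) by (simp add: algebra_simps)
  then have "- t \<le> - c \<or> - b \<le> - t \<and> - t \<le> - a"
    using assms by (intro cubic_nonpos_cases) auto
  then show ?thesis by auto
qed

lemma cubic_IVT:
  assumes X: "compact_space X" "Hausdorff_space X" and F: "F_space X"
    and HI: "hereditarily_indecomposable X"
    and a: "continuous_map X euclideanreal a" and b: "continuous_map X euclideanreal b"
    and c: "continuous_map X euclideanreal c" and u: "continuous_map X euclideanreal u"
    and v: "continuous_map X euclideanreal v"
    and abc: "\<And>x. x \<in> topspace X \<Longrightarrow> a x \<le> b x \<and> b x \<le> c x"
    and uv: "\<And>x. x \<in> topspace X \<Longrightarrow> u x \<le> v x"
    and pu: "\<And>x. x \<in> topspace X \<Longrightarrow> (u x - a x) * (u x - b x) * (u x - c x) \<le> 0"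
    and pv: "\<And>x. x \<in> topspace X \<Longrightarrow> 0 \<le> (v x - a x) * (v x - b x) * (v x - c x)"
  obtains w where "continuous_map X euclideanreal w"
    "\<And>x. x \<in> topspace X \<Longrightarrow> u x \<le> w x \<and> w x \<le> v x"
    "\<And>x. x \<in> topspace X \<Longrightarrow> w x \<in> {a x, b x, c x}"
proof -
  have uc: "u x \<le> a x \<or> b x \<le> u x \<and> u x \<le> c x" if "x \<in> topspace X" for x
    using cubic_nonpos_cases abc pu that by blast
  have vc: "a x \<le> v x \<and> v x \<le> b x \<or> c x \<le> v x" if "x \<in> topspace X" for x
    using cubic_nonneg_cases abc pv that by blast
  define G where "G = {x \<in> topspace X. max (a x) (u x) < b x}"
  define E where "E = {x \<in> topspace X. b x < min (c x) (v x)}"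
  let ?A = "{x \<in> topspace X. v x < b x}" and ?B = "{x \<in> topspace X. b x < u x}"
  \<comment> \<open>If \<open>v < b\<close>, then \<open>v < c\<close>, so \<open>vc\<close> leaves
    \<open>a \<le> v < b\<close>; moreover \<open>u \<le> v < b\<close>. The inclusion
    \<open>BE\<close> is dual.\<close>
  have AG: "?A \<subseteq> G" 
    using uv vc abc unfolding G_def by fastforce
  have BE: "?B \<subseteq> E"
    using uv uc abc unfolding E_def by fastforce
  have G: "openin X G" and E: "openin X E"
    unfolding G_def E_def by (intro openin_less continuous_intros a b c u v)+
  have "X closure_of E \<subseteq> X closure_of {x \<in> topspace X. b x < v x}"
    by (rule closure_of_mono) (auto simp: E_def)
  then have disj1: "X closure_of ?A \<inter> X closure_of E = {}"
    using F_space_disjoint_closures[OF F v b] by blast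
  have "X closure_of G \<subseteq> X closure_of {x \<in> topspace X. u x < b x}"
    by (rule closure_of_mono) (auto simp: G_def)
  then have disj2: "X closure_of ?B \<inter> X closure_of G = {}"
    using F_space_disjoint_closures[OF F u b] by blast
  obtain H J where H: "closedin (subtopology X (X closure_of G)) H"
      "openin (subtopology X (X closure_of G)) H" "X closure_of ?A \<subseteq> H"
    and J: "closedin (subtopology X (X closure_of E)) J"
      "openin (subtopology X (X closure_of E)) J" "X closure_of ?B \<subseteq> J" and HJ: "H \<inter> J = {}"
    by (rule hereditarily_indecomposable_separation[OF X HI, of "X closure_of G" "X closure_of E"
          "X closure_of ?A" "X closure_of ?B"])
      (use disj1 disj2 in \<open>auto simp: closure_of_mono[OF AG] closure_of_mono[OF BE]\<close>)
  have inH: "x \<in> H" if "x \<in> topspace X" "v x < b x" for x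
    using closure_of_subset[of ?A X] H(3) that by auto
  have inJ: "x \<in> J" if "x \<in> topspace X" "b x < u x" for x
    using closure_of_subset[of ?B X] J(3) that by auto
  \<comment> \<open>As \<open>H\<close> and \<open>J\<close> are disjoint, at most one correction
    acts: \<open>w\<close> is \<open>a\<close> on \<open>G \<inter> H\<close>, \<open>c\<close> on
    \<open>E \<inter> J\<close>, and \<open>b\<close> elsewhere.\<close>
  define w where "w x = b x - (if x \<in> G \<inter> H then b x - a x else 0)
      + (if x \<in> E \<inter> J then c x - b x else 0)" for x
  \<comment> \<open>On \<open>G\<close> the sign at \<open>u\<close> forces
    \<open>u \<le> a\<close>. This supplies the closed set needed for continuity and the bound
    \<open>u \<le> w\<close> where \<open>w = a\<close>.\<close>
  have G_eq: "G = {x \<in> {x \<in> topspace X. u x \<le> a x}. a x < b x}"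
    using uc abc by (force simp: G_def)
  have E_eq: "E = {x \<in> {x \<in> topspace X. c x \<le> v x}. b x < c x}"
    using vc abc by (force simp: E_def)
  have "continuous_map X euclideanreal w"
    unfolding w_def
    by (intro continuous_intros b clopen_part_truncate[OF a b G _ G_eq H(1,2)]
        clopen_part_truncate[OF b c E _ E_eq J(1,2)] closedin_le u v a c)
  moreover have "u x \<le> w x \<and> w x \<le> v x" if x: "x \<in> topspace X" for x
  proof -
    consider "x \<in> G \<inter> H" "x \<notin> E \<inter> J" | "x \<notin> G \<inter> H" "x \<in> E \<inter> J" | "x \<notin> G \<inter> H" "x \<notin> E \<inter> J"
      using HJ by blast
    then show ?thesis
    proof cases
      case 1
      then show ?thesis using x G_eq vc[OF x] abc[OF x] by (auto simp: w_def)
    next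
      case 2
      then show ?thesis using x E_eq uc[OF x] abc[OF x] by (auto simp: w_def)
    next
      case 3
      \<comment> \<open>Here \<open>w = b\<close>; a point with \<open>v < b\<close> would lie in
        \<open>G \<inter> H\<close>, one with \<open>b < u\<close> in
        \<open>E \<inter> J\<close>.\<close>
      then show ?thesis using x inH[OF x] inJ[OF x] AG BE by (force simp: w_def)
    qed
  qed
  moreover have "w x \<in> {a x, b x, c x}" for x
    using HJ by (auto simp: w_def)
  ultimately show thesis using that by blast
qed

section \<open>Reduction of the degree\<close>

text \<open>
  The clause on upper bounds \<open>k\<close> makes the maxima of repeated extractions decreasing.
\<close>

lemma extract_maximum:
  assumes "\<forall>f\<in>set (h # fs). continuous_map X euclideanreal f"
  shows "\<exists>m gs. continuous_map X euclideanreal m \<and> (\<forall>g\<in>set gs. continuous_map X euclideanreal g) \<and>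
    length gs = length fs \<and> (\<forall>x. h x \<le> m x) \<and> (\<forall>g\<in>set gs. \<forall>x. g x \<le> m x) \<and>
    (\<forall>k. (\<forall>g\<in>set (h # fs). \<forall>x. g x \<le> k x) \<longrightarrow> (\<forall>g\<in>set (m # gs). \<forall>x. g x \<le> k x)) \<and>
    (\<forall>t x. (\<Prod>f\<leftarrow>h # fs. t - f x) = (t - m x) * (\<Prod>g\<leftarrow>gs. t - g x :: real))"
  using assms
proof (induction fs arbitrary: h)
  case Nil
  then show ?case by (intro exI[of _ h] exI[of _ "[]"]) auto
next
  case (Cons f fs)
  \<comment> \<open>As in a bubble sort, the larger of two roots moves on and the smaller is put
    aside; the product of the two factors is unchanged.\<close>
  let ?hi = "\<lambda>x. max (h x) (f x)" and ?lo = "\<lambda>x. min (h x) (f x)"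
  have "\<forall>g\<in>set (?hi # fs). continuous_map X euclideanreal g"
    using Cons.prems by (auto intro: continuous_intros)
  from Cons.IH[OF this] obtain m gs where
    m: "continuous_map X euclideanreal m" "\<forall>g\<in>set gs. continuous_map X euclideanreal g"
      "length gs = length fs" "\<forall>x. ?hi x \<le> m x" "\<forall>g\<in>set gs. \<forall>x. g x \<le> m x"
    and k: "\<And>k. (\<forall>g\<in>set (?hi # fs). \<forall>x. g x \<le> k x) \<Longrightarrow> (\<forall>g\<in>set (m # gs). \<forall>x. g x \<le> k x)"
    and p: "\<And>t x. (\<Prod>f\<leftarrow>?hi # fs. t - f x) = (t - m x) * (\<Prod>g\<leftarrow>gs. t - g x :: real)"
    by blast
  have prod: "(\<Prod>g\<leftarrow>h # f # fs. t - g x) = (t - m x) * (\<Prod>g\<leftarrow>?lo # gs. t - g x)" for t x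
  proof -
    have "(\<Prod>g\<leftarrow>h # f # fs. t - g x) = (t - ?lo x) * (\<Prod>f\<leftarrow>?hi # fs. t - f x)"
      by (simp add: min_def max_def)
    also have "\<dots> = (t - m x) * (\<Prod>g\<leftarrow>?lo # gs. t - g x)"
      unfolding p by simp
    finally show ?thesis .
  qed
  have bound: "\<forall>g\<in>set (m # ?lo # gs). \<forall>x. g x \<le> k x"
    if "\<forall>g\<in>set (h # f # fs). \<forall>x. g x \<le> k x" for k
    using k[of k] that by (auto simp: min_def)
  have lo: "h x \<le> m x" "?lo x \<le> m x" for x
    using m(4)[rule_format, of x] by auto
  have "continuous_map X euclideanreal ?lo"
    using Cons.prems by (auto intro: continuous_intros)
  then show ?case
    by (intro exI[of _ m] exI[of _ "?lo # gs"] conjI allI impI prod bound lo m(1))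
      (use m lo in simp_all)
qed

text \<open>Induction on the number of roots. The three largest, \<open>a \<le> b \<le> c\<close>,
  are replaced by one continuous selection \<open>w\<close> from them, chosen so that the signs at
  \<open>u\<close> and \<open>v\<close> persist.\<close>

lemma ordered_IVT:
  assumes X: "compact_space X" "Hausdorff_space X" and F: "F_space X"
    and HI: "hereditarily_indecomposable X"
    and fs: "\<forall>f\<in>set fs. continuous_map X euclideanreal f"
    and u: "continuous_map X euclideanreal u" and v: "continuous_map X euclideanreal v"
    and uv: "\<forall>x\<in>topspace X. u x \<le> v x"
    and p: "\<forall>x\<in>topspace X. (\<Prod>f\<leftarrow>fs. u x - f x) \<le> 0 \<and> 0 \<le> (\<Prod>f\<leftarrow>fs. v x - f x)"
  shows "\<exists>w. continuous_map X euclideanreal w \<and> (\<forall>x\<in>topspace X. u x \<le> w x \<and> w x \<le> v x) \<and>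
    (\<forall>x\<in>topspace X. (\<Prod>f\<leftarrow>fs. w x - f x) = 0)"
  using fs p
proof (induction fs rule: length_induct)
  case (1 fs)
  note fs = 1(2) and p = 1(3)
  consider "fs = []" | f where "fs = [f]" | f g where "fs = [f, g]" | "3 \<le> length fs"
    by (cases fs rule: remdups_adj.cases) (auto simp: Suc_le_eq numeral_3_eq_3 neq_Nil_conv, metis neq_Nil_conv)
  then show ?case
  proof cases
    case 1
    \<comment> \<open>The empty product is \<open>1\<close>, which cannot be \<open>\<le> 0\<close>
      at any point.\<close>
    then have "topspace X = {}" using p by auto
    then show ?thesis using u by auto
  next
    case (2 f)
    then show ?thesis using fs p by (intro exI[of _ f]) auto
  next
    case (3 f g)
    \<comment> \<open>A third root below \<^term>\<open>u\<close> does not affect the signs.\<close>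
    let ?a = "\<lambda>x. min (u x) (min (f x) (g x)) - 1"
    let ?b = "\<lambda>x. min (f x) (g x)" and ?c = "\<lambda>x. max (f x) (g x)"
    have f: "continuous_map X euclideanreal f" and g: "continuous_map X euclideanreal g"
      using fs 3 by auto
    have eq: "(t - ?a x) * (t - ?b x) * (t - ?c x) = (t - ?a x) * ((t - f x) * (t - g x))" for t x
      by (simp add: min_def max_def)
    have "continuous_map X euclideanreal ?a" "continuous_map X euclideanreal ?b"
         "continuous_map X euclideanreal ?c"
      by (intro continuous_intros u f g continuous_map_const[THEN iffD2] disjI2; simp)+
    then obtain w where w: "continuous_map X euclideanreal w"
      "\<And>x. x \<in> topspace X \<Longrightarrow> u x \<le> w x \<and> w x \<le> v x"
      "\<And>x. x \<in> topspace X \<Longrightarrow> w x \<in> {?a x, ?b x, ?c x}"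
    proof (rule cubic_IVT[OF X F HI, of ?a ?b ?c u v])
      fix x assume x: "x \<in> topspace X"
      show "(u x - ?a x) * (u x - ?b x) * (u x - ?c x) \<le> 0"
        unfolding eq using p x 3 mult_nonneg_nonpos[of "u x - ?a x" "(u x - f x) * (u x - g x)"]
        by auto
      have "u x \<le> v x" using uv x by auto
      then show "0 \<le> (v x - ?a x) * (v x - ?b x) * (v x - ?c x)"
        unfolding eq using p x 3 mult_nonneg_nonneg[of "v x - ?a x" "(v x - f x) * (v x - g x)"]
        by auto
    qed (use u v uv in auto)
    \<comment> \<open>The auxiliary root is strictly below \<open>u \<le> w\<close>, so
      \<open>w\<close> never takes it.\<close>
    have "w x = f x \<or> w x = g x" if "x \<in> topspace X" for x
      using w(2,3)[OF that] by (auto simp: min_def max_def split: if_splits)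
    then show ?thesis
      using w 3 by (intro exI[of _ w]) auto
  next
    case 4
    obtain h1 r1 where r1: "fs = h1 # r1" using 4 by (cases fs) auto
    obtain c s1 where c: "continuous_map X euclideanreal c" "\<forall>g\<in>set s1. continuous_map X euclideanreal g"
      "length s1 = length r1" "\<forall>g\<in>set s1. \<forall>x. g x \<le> c x"
      and pc: "\<And>t x. (\<Prod>f\<leftarrow>fs. t - f x) = (t - c x) * (\<Prod>g\<leftarrow>s1. t - g x :: real)"
      using extract_maximum[of h1 r1 X] fs unfolding r1 by blast
    obtain h2 r2 where r2: "s1 = h2 # r2" using 4 c(3) r1 by (cases s1) auto
    obtain b s2 where b: "continuous_map X euclideanreal b" "\<forall>g\<in>set s2. continuous_map X euclideanreal g"
      "length s2 = length r2" "\<forall>g\<in>set s2. \<forall>x. g x \<le> b x" "\<And>x. b x \<le> c x"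
      and pb: "\<And>t x. (\<Prod>f\<leftarrow>s1. t - f x) = (t - b x) * (\<Prod>g\<leftarrow>s2. t - g x :: real)"
      using extract_maximum[of h2 r2 X] c(2,4) unfolding r2 by (metis list.set_intros(1))
    obtain h3 r3 where r3: "s2 = h3 # r3" using 4 c(3) b(3) r1 r2 by (cases s2) auto
    obtain a r where a: "continuous_map X euclideanreal a" "\<forall>g\<in>set r. continuous_map X euclideanreal g"
      "length r = length r3" "\<forall>g\<in>set r. \<forall>x. g x \<le> a x" "\<And>x. a x \<le> b x"
      and pa: "\<And>t x. (\<Prod>f\<leftarrow>s2. t - f x) = (t - a x) * (\<Prod>g\<leftarrow>r. t - g x :: real)"
      using extract_maximum[of h3 r3 X] b(2,4) unfolding r3 by (metis list.set_intros(1))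
    define R where "R t x = (\<Prod>g\<leftarrow>r. t - g x)" for t x
    have prod: "(\<Prod>f\<leftarrow>fs. t - f x) = (t - a x) * (t - b x) * (t - c x) * R t x" for t x
      unfolding pc pb pa R_def by (simp add: mult_ac)
    have R_nonneg: "0 \<le> R t x" if "a x \<le> t" for t x
    proof -
      have "\<forall>g\<in>set r. g x \<le> t" using a(4) that by (meson order_trans)
      then show ?thesis unfolding R_def by (induction r) auto
    qed
    have R_pos: "0 < R t x" if "a x < t" for t x
    proof -
      have "\<forall>g\<in>set r. g x < t" using a(4) that by (meson order_le_less_trans)
      then show ?thesis unfolding R_def by (induction r) auto
    qed
    have low: "(t - a x) * (t - b x) * (t - c x) < 0" if "t < a x" for t x
    proof -
      have "t < b x" "t < c x" using that a(5)[of x] b(5)[of x] by auto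
      with that show ?thesis by (simp add: mult_neg_neg mult_pos_neg)
    qed
    have pu: "(u x - a x) * (u x - b x) * (u x - c x) * R (u x) x \<le> 0"
      and pv: "0 \<le> (v x - a x) * (v x - b x) * (v x - c x) * R (v x) x" if "x \<in> topspace X" for x
      using p that unfolding prod by auto
    \<comment> \<open>The cubic case is applied to \<open>u\<close> and \<open>v\<close> raised to
      at least \<open>a\<close>. Where raising changes the value, it becomes the root
      \<open>a\<close>; above \<open>a\<close> the factor \<open>R\<close> is positive and
      cancels.\<close>
    obtain w where w: "continuous_map X euclideanreal w"
      "\<And>x. x \<in> topspace X \<Longrightarrow> max (u x) (a x) \<le> w x \<and> w x \<le> max (v x) (a x)"
      "\<And>x. x \<in> topspace X \<Longrightarrow> w x \<in> {a x, b x, c x}"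
    proof (rule cubic_IVT[OF X F HI a(1) b(1) c(1), of "\<lambda>x. max (u x) (a x)" "\<lambda>x. max (v x) (a x)"])
      fix x assume x: "x \<in> topspace X"
      show "a x \<le> b x \<and> b x \<le> c x" using a b by auto
      show "max (u x) (a x) \<le> max (v x) (a x)" using uv x by auto
      show "(max (u x) (a x) - a x) * (max (u x) (a x) - b x) * (max (u x) (a x) - c x) \<le> 0"
        using pu[OF x] R_pos[of x "u x"] by (cases "a x < u x") (auto simp: max_def mult_le_0_iff)
      show "0 \<le> (max (v x) (a x) - a x) * (max (v x) (a x) - b x) * (max (v x) (a x) - c x)"
        using pv[OF x] R_pos[of x "v x"] by (cases "a x < v x") (auto simp: max_def zero_le_mult_iff)
    qed (auto intro!: continuous_intros u v a)
    have "length (w # r) < length fs"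
      using a(3) b(3) c(3) r1 r2 r3 by simp
    moreover have "\<forall>g\<in>set (w # r). continuous_map X euclideanreal g"
      using w(1) a(2) by simp
    moreover have "(\<Prod>g\<leftarrow>w # r. u x - g x) \<le> 0 \<and> 0 \<le> (\<Prod>g\<leftarrow>w # r. v x - g x)"
      if x: "x \<in> topspace X" for x
    proof
      \<comment> \<open>Where \<open>a \<le> u\<close>, \<open>R\<close> is nonnegative; where
        \<open>u < a\<close>, the cubic is negative, so \<open>pu\<close> again gives
        \<open>R \<ge> 0\<close>. Always \<open>u \<le> w\<close>. At \<open>v < a\<close>, both
        factors are nonpositive instead.\<close>
      have "(u x - w x) * R (u x) x \<le> 0"
      proof (cases "a x \<le> u x")
        case True
        then show ?thesis using R_nonneg[OF True] w(2)[OF x] by (intro mult_nonpos_nonneg) auto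
      next
        case False
        then have "0 \<le> R (u x) x" using pu[OF x] low[of "u x" x] by (simp add: mult_le_0_iff)
        then show ?thesis using w(2)[OF x] by (intro mult_nonpos_nonneg) auto
      qed
      then show "(\<Prod>g\<leftarrow>w # r. u x - g x) \<le> 0" by (simp add: R_def)
      have "0 \<le> (v x - w x) * R (v x) x"
      proof (cases "a x \<le> v x")
        case True
        then show ?thesis using R_nonneg[OF True] w(2)[OF x] by (intro mult_nonneg_nonneg) auto
      next
        case False
        then have "R (v x) x \<le> 0" using pv[OF x] low[of "v x" x]
          by (metis less_le_not_le linorder_not_le mult_neg_pos)
        then show ?thesis using w(2)[OF x] False by (intro mult_nonpos_nonpos) auto
      qed
      then show "0 \<le> (\<Prod>g\<leftarrow>w # r. v x - g x)" by (simp add: R_def)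
    qed
    ultimately obtain z where z: "continuous_map X euclideanreal z"
      "\<forall>x\<in>topspace X. u x \<le> z x \<and> z x \<le> v x" "\<forall>x\<in>topspace X. (\<Prod>g\<leftarrow>w # r. z x - g x) = 0"
      using 1(1)[rule_format, of "w # r"] by blast
    have "(\<Prod>f\<leftarrow>fs. z x - f x) = 0" if x: "x \<in> topspace X" for x
    proof -
      have "z x = w x \<or> R (z x) x = 0"
        using z(3) x unfolding R_def by simp
      then show ?thesis using w(3)[OF x] unfolding prod by auto
    qed
    with z show ?thesis by blast
  qed
qed

section \<open>Arbitrary \<open>u\<close> and \<open>v\<close>\<close>

lemma factored_poly_conv_prod_list:
  "factored_poly n f u x = (\<Prod>g\<leftarrow>map f [1..<Suc n]. u x - g x)"
proof -
  have "(\<Prod>i=1..n. u x - f i x) = (\<Prod>i\<in>set [1..<Suc n]. u x - f i x)"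
    by (intro prod.cong) auto
  also have "\<dots> = (\<Prod>i\<leftarrow>[1..<Suc n]. u x - f i x)"
    by (rule prod.distinct_set_conv_list) simp
  finally show ?thesis
    by (simp add: factored_poly_def o_def del: upt_Suc)
qed

text \<open>The ordered case is applied on the closed sets \<open>u \<le> v\<close> and
  \<open>v \<le> u\<close>. The two solutions glue, since both are squeezed to the common value
  where \<open>u = v\<close>.\<close>

lemma hereditarily_indecomposable_imp_IVT:
  assumes X: "compact_space X" "Hausdorff_space X" and F: "F_space X"
    and HI: "hereditarily_indecomposable X"
  shows "IVT_completely_factored X"
  unfolding IVT_completely_factored_def
proof (intro allI impI, elim conjE)
  fix n :: nat and f and u v :: "'a \<Rightarrow> real"
  assume f: "\<forall>i\<in>{1..n}. continuous_map X euclideanreal (f i)"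
    and u: "continuous_map X euclideanreal u" and v: "continuous_map X euclideanreal v"
    and p: "\<forall>x\<in>topspace X. factored_poly n f u x \<le> 0 \<and> 0 \<le> factored_poly n f v x"
  define fs where "fs = map f [1..<Suc n]"
  have fs: "\<forall>g\<in>set fs. continuous_map X euclideanreal g"
    using f by (auto simp: fs_def)
  have p: "(\<Prod>g\<leftarrow>fs. u x - g x) \<le> 0" "0 \<le> (\<Prod>g\<leftarrow>fs. v x - g x)" if "x \<in> topspace X" for x
    using p that unfolding factored_poly_conv_prod_list fs_def by auto
  let ?U = "{x \<in> topspace X. u x \<le> v x}" and ?V = "{x \<in> topspace X. v x \<le> u x}"
  have sub: "compact_space (subtopology X S)" "Hausdorff_space (subtopology X S)"
    "F_space (subtopology X S)" "hereditarily_indecomposable (subtopology X S)"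
    if "closedin X S" for S
    using that X F HI
    by (auto simp: F_space_subtopology hereditarily_indecomposable_subtopology
        Hausdorff_space_subtopology closedin_compact_space compact_space_subtopology)
  have U: "closedin X ?U" and V: "closedin X ?V"
    by (intro closedin_le u v)+
  have "\<exists>w. continuous_map (subtopology X ?U) euclideanreal w \<and>
      (\<forall>x\<in>topspace (subtopology X ?U). u x \<le> w x \<and> w x \<le> v x) \<and>
      (\<forall>x\<in>topspace (subtopology X ?U). (\<Prod>g\<leftarrow>fs. w x - g x) = 0)"
    by (rule ordered_IVT[OF sub[OF U]]) (use fs u v p in \<open>auto intro: continuous_map_from_subtopology\<close>)
  then obtain y where y: "continuous_map (subtopology X ?U) euclideanreal y"
    "\<And>x. x \<in> ?U \<Longrightarrow> u x \<le> y x \<and> y x \<le> v x" "\<And>x. x \<in> ?U \<Longrightarrow> (\<Prod>g\<leftarrow>fs. y x - g x) = 0"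
    by auto
  let ?h = "\<lambda>x. max (u x) (v x) + 1"
  have h: "continuous_map X euclideanreal ?h"
    by (intro continuous_intros u v) simp
  \<comment> \<open>An additional root above \<^term>\<open>u\<close> and \<^term>\<open>v\<close> exchanges the two signs.\<close>
  have "\<exists>w. continuous_map (subtopology X ?V) euclideanreal w \<and>
      (\<forall>x\<in>topspace (subtopology X ?V). v x \<le> w x \<and> w x \<le> u x) \<and>
      (\<forall>x\<in>topspace (subtopology X ?V). (\<Prod>g\<leftarrow>?h # fs. w x - g x) = 0)"
  proof (rule ordered_IVT[OF sub[OF V]])
    show "\<forall>x\<in>topspace (subtopology X ?V). (\<Prod>g\<leftarrow>?h # fs. v x - g x) \<le> 0 \<and> 0 \<le> (\<Prod>g\<leftarrow>?h # fs. u x - g x)"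
    proof
      fix x assume "x \<in> topspace (subtopology X ?V)"
      then have x: "x \<in> topspace X" by simp
      have "(v x - ?h x) * (\<Prod>g\<leftarrow>fs. v x - g x) \<le> 0"
        by (rule mult_nonpos_nonneg) (use p(2)[OF x] in auto)
      moreover have "0 \<le> (u x - ?h x) * (\<Prod>g\<leftarrow>fs. u x - g x)"
        by (rule mult_nonpos_nonpos) (use p(1)[OF x] in auto)
      ultimately show "(\<Prod>g\<leftarrow>?h # fs. v x - g x) \<le> 0 \<and> 0 \<le> (\<Prod>g\<leftarrow>?h # fs. u x - g x)"
        by simp
    qed
  qed (use fs u v h in \<open>auto intro: continuous_map_from_subtopology\<close>)
  then obtain z where z: "continuous_map (subtopology X ?V) euclideanreal z"
    "\<And>x. x \<in> ?V \<Longrightarrow> v x \<le> z x \<and> z x \<le> u x" "\<And>x. x \<in> ?V \<Longrightarrow> (\<Prod>g\<leftarrow>?h # fs. z x - g x) = 0"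
    by auto
  have z_root: "(\<Prod>g\<leftarrow>fs. z x - g x) = 0" if "x \<in> ?V" for x
  proof -
    have "z x < ?h x" using z(2)[OF that] by auto
    then show ?thesis using z(3)[OF that] by auto
  qed
  let ?w = "\<lambda>x. if u x \<le> v x then y x else z x"
  have "continuous_map X euclideanreal ?w"
  proof (rule continuous_map_cases_le[OF u v y(1) z(1)])
    fix x assume "x \<in> topspace X" "u x = v x"
    then show "y x = z x" using y(2)[of x] z(2)[of x] by auto
  qed
  moreover have "min (u x) (v x) \<le> ?w x \<and> ?w x \<le> max (u x) (v x)"
      and "factored_poly n f ?w x = 0" if "x \<in> topspace X" for x
    using that y(2,3)[of x] z(2)[of x] z_root[of x]
    unfolding factored_poly_conv_prod_list fs_def[symmetric] by auto
  ultimately show "\<exists>w. continuous_map X euclideanreal w \<and>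
      (\<forall>x\<in>topspace X. min (u x) (v x) \<le> w x \<and> w x \<le> max (u x) (v x)) \<and>
      (\<forall>x\<in>topspace X. factored_poly n f w x = 0)"
    by blast
qed

section \<open>From the IVT to indecomposability\<close>

lemma IVT_completely_factoredE:
  assumes "IVT_completely_factored X" "1 \<le> n"
    and "\<And>i. continuous_map X euclideanreal (f i)"
    and "continuous_map X euclideanreal u" "continuous_map X euclideanreal v"
    and "\<And>x. x \<in> topspace X \<Longrightarrow> factored_poly n f u x \<le> 0"
    and "\<And>x. x \<in> topspace X \<Longrightarrow> 0 \<le> factored_poly n f v x"
  obtains w where "continuous_map X euclideanreal w"
    "\<And>x. x \<in> topspace X \<Longrightarrow> min (u x) (v x) \<le> w x \<and> w x \<le> max (u x) (v x)"
    "\<And>x. x \<in> topspace X \<Longrightarrow> factored_poly n f w x = 0"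
  using assms(1)[unfolded IVT_completely_factored_def, THEN spec, THEN mp, OF assms(2),
      THEN spec, THEN spec, THEN spec, THEN mp, of f u v] assms(3-) by blast

lemma connectedin_avoiding_value:
  assumes w: "continuous_map X euclideanreal w" and A: "connectedin X A"
    and avoid: "\<And>x. x \<in> A \<Longrightarrow> w x \<noteq> c" and a: "a \<in> A" "w a < c" and x: "x \<in> A"
  shows "w x < c"
proof (rule ccontr)
  assume "\<not> w x < c"
  moreover have "connected (w ` A)"
    using connectedin_continuous_map_image[OF w A] by simp
  ultimately have "c \<in> w ` A"
    using connectedD_interval[of "w ` A" "w a" "w x" c] a x by auto
  then show False using avoid by auto
qed

text \<open>
  For the converse, suppose that the continua \<open>A\<close> and \<open>B\<close> overlap, with \<open>a \<in> A - B\<close> and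
  \<open>b \<in> B - A\<close>. Let \<open>h\<close> be nonnegative on \<open>A\<close> and nonpositive on \<open>B\<close>, with \<open>h a = 1\<close> and
  \<open>h b = -1\<close>. Take the roots \<open>-1\<close>, \<open>f = 2h\<close> cut off at \<open>\<plusminus>1\<close>, and \<open>1\<close>. The function \<open>v\<close>
  may pass from \<open>-1\<close> to \<open>1\<close> where \<open>f = 1\<close>, near \<open>a\<close>, whereas \<open>u\<close> may do so where \<open>f = -1\<close>,
  near \<open>b\<close>. A root \<open>w\<close> between them is \<open>-1\<close> at \<open>a\<close> and \<open>1\<close> at \<open>b\<close>, but it cannot leave
  \<open>-1\<close> inside \<open>A\<close>, where \<open>f \<ge> 0\<close>, nor \<open>1\<close> inside \<open>B\<close>, where \<open>f \<le> 0\<close>.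
\<close>

lemma IVT_imp_disjoint:
  assumes X: "compact_space X" "Hausdorff_space X" and IVT: "IVT_completely_factored X"
    and A: "closedin X A" "connectedin X A" and B: "closedin X B" "connectedin X B"
    and a: "a \<in> A" "a \<notin> B" and b: "b \<in> B" "b \<notin> A"
  shows "A \<inter> B = {}"
proof -
  have normal: "normal_space X"
    using X by (simp add: compact_Hausdorff_or_regular_imp_normal_space)
  have pts: "a \<in> topspace X" "b \<in> topspace X"
    using a b A B closedin_subset by blast+
  have "closedin X {a}" "closedin X {b}"
    using X(2) pts by (auto intro: closedin_Hausdorff_singleton)
  then obtain h1 h2 where
    h1: "continuous_map X (top_of_set {0..1}) h1" "h1 ` B \<subseteq> {0}" "h1 ` {a} \<subseteq> {1::real}" and
    h2: "continuous_map X (top_of_set {0..1}) h2" "h2 ` A \<subseteq> {0}" "h2 ` {b} \<subseteq> {1::real}"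
    using Urysohn_lemma[OF normal B(1), of "{a}" 0 1] Urysohn_lemma[OF normal A(1), of "{b}" 0 1] a b
    by (metis disjnt_insert2 disjnt_empty2 zero_le_one)
  have range: "0 \<le> h1 x" "h1 x \<le> 1" "0 \<le> h2 x" "h2 x \<le> 1" if "x \<in> topspace X" for x
    using h1(1) h2(1) that by (auto simp: continuous_map_in_subtopology)
  define h where "h x = h1 x - h2 x" for x
  have h: "continuous_map X euclideanreal h"
    using h1(1) h2(1) unfolding h_def
    by (intro continuous_intros) (auto simp: continuous_map_in_subtopology)
  have hA: "0 \<le> h x" if "x \<in> A" for x
  proof -
    have "x \<in> topspace X" "h2 x = 0"
      using that h2(2) closedin_subset[OF A(1)] by blast+
    then show ?thesis using range by (simp add: h_def)
  qed
  have hB: "h x \<le> 0" if "x \<in> B" for x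
  proof -
    have "x \<in> topspace X" "h1 x = 0"
      using that h1(2) closedin_subset[OF B(1)] by blast+
    then show ?thesis using range by (simp add: h_def)
  qed
  have hab: "h a = 1" "h b = -1"
    using h1(2,3) h2(2,3) a(1) b(1) unfolding h_def by (simp_all add: image_subset_iff)
  define clamp :: "real \<Rightarrow> real" where "clamp t = max (-1) (min 1 t)" for t
  \<comment> \<open>One affine form covers the middle root and both \<open>?u\<close> and
    \<open>?v\<close>.\<close>
  have cont: "continuous_map X euclideanreal (\<lambda>x. clamp (c + d * h x))" for c d
    unfolding clamp_def by (intro continuous_intros h) simp_all
  let ?f = "\<lambda>i x. if i = (1::nat) then -1 else if i = 2 then clamp (0 + 2 * h x) else 1"
  \<comment> \<open>\<open>?u\<close> falls from \<open>1\<close> at \<open>h = -1\<close> to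
    \<open>-1\<close> at \<open>h = -1/2\<close>, exactly where the middle root reaches
    \<open>-1\<close>; \<open>?v\<close> falls from \<open>1\<close> at \<open>h = 1/2\<close> to
    \<open>-1\<close> at \<open>h = 1\<close>.\<close>
  let ?u = "\<lambda>x. clamp (-3 + (-4) * h x)" and ?v = "\<lambda>x. clamp (3 + (-4) * h x)"
  have poly: "factored_poly 3 ?f y x = (y x + 1) * (y x - clamp (2 * h x)) * (y x - 1)" for y x
    by (simp add: factored_poly_def numeral_3_eq_3 numeral_2_eq_2)
  have f: "continuous_map X euclideanreal (?f i)" for i
    using cont[of 0 2] by (cases "i = 1"; cases "i = 2") simp_all
  have pu: "factored_poly 3 ?f ?u x \<le> 0" for x
  proof (cases "h x \<le> - 1/2")
    case True
    then have "clamp (2 * h x) = -1" by (simp add: clamp_def)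
    moreover have "(t + 1) * (t + 1) * (t - 1) \<le> 0" if "t \<le> 1" for t :: real
      using that by (intro mult_nonneg_nonpos) auto
    ultimately show ?thesis unfolding poly by (simp add: clamp_def)
  next
    case False
    then have "?u x = -1" by (simp add: clamp_def)
    then show ?thesis unfolding poly by simp
  qed
  have pv: "0 \<le> factored_poly 3 ?f ?v x" for x
  proof (cases "1/2 \<le> h x")
    case True
    then have "clamp (2 * h x) = 1" by (simp add: clamp_def)
    moreover have "0 \<le> (t + 1) * (t - 1) * (t - 1)" if "-1 \<le> t" for t :: real
      using that by (simp add: mult.assoc)
    ultimately show ?thesis unfolding poly by (simp add: clamp_def)
  next
    case False
    then have "?v x = 1" by (simp add: clamp_def)
    then show ?thesis unfolding poly by simp
  qed
  obtain w where w: "continuous_map X euclideanreal w"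
    "\<And>x. x \<in> topspace X \<Longrightarrow> min (?u x) (?v x) \<le> w x \<and> w x \<le> max (?u x) (?v x)"
    "\<And>x. x \<in> topspace X \<Longrightarrow> factored_poly 3 ?f w x = 0"
    by (rule IVT_completely_factoredE[OF IVT _ f cont cont pu pv]) (simp, rule that)
  have root: "w x = -1 \<or> w x = clamp (2 * h x) \<or> w x = 1" if "x \<in> topspace X" for x
    using w(3)[OF that] unfolding poly by auto
  \<comment> \<open>\<open>?u\<close> and \<open>?v\<close> agree at both points: they are
    \<open>-1\<close> at \<open>a\<close> and \<open>1\<close> at \<open>b\<close>.\<close>
  have wab: "w a = -1" "w b = 1"
    using w(2)[OF pts(1)] w(2)[OF pts(2)] by (auto simp: hab clamp_def)
  \<comment> \<open>On \<open>A\<close> the only possible negative value of \<open>w\<close> is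
    \<open>-1\<close>, so \<open>-1/2\<close> is skipped. Dually \<open>w\<close> skips
    \<open>1/2\<close> on \<open>B\<close>, and a common point would satisfy both
    \<open>w < -1/2\<close> and \<open>w > 1/2\<close>.\<close>
  have "w x < - 1/2" if "x \<in> A" for x
  proof (rule connectedin_avoiding_value[OF w(1) A(2) _ a(1) _ that])
    fix x assume "x \<in> A"
    then show "w x \<noteq> - 1/2"
      using root[of x] hA[of x] closedin_subset[OF A(1)] by (auto simp: clamp_def)
  qed (simp add: wab)
  moreover have "- w x < - 1/2" if "x \<in> B" for x
  proof (rule connectedin_avoiding_value[OF continuous_map_minus[OF w(1)] B(2) _ b(1) _ that])
    fix x assume "x \<in> B"
    then show "- w x \<noteq> - 1/2"
      using root[of x] hB[of x] closedin_subset[OF B(1)] by (auto simp: clamp_def)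
  qed (simp add: wab)
  ultimately show ?thesis by fastforce
qed

text \<open>Two proper subcontinua covering \<open>K\<close> do not contain each other, so they are
  disjoint by \<open>IVT_imp_disjoint\<close>; being closed and nonempty, they would disconnect
  \<open>K\<close>.\<close>

lemma IVT_imp_hereditarily_indecomposable:
  assumes X: "compact_space X" "Hausdorff_space X" and IVT: "IVT_completely_factored X"
  shows "hereditarily_indecomposable X"
  unfolding hereditarily_indecomposable_def
proof (intro allI impI, elim conjE)
  fix K assume K: "K \<noteq> {}" "closedin X K" "connectedin X K"
  have KX: "K \<subseteq> topspace X"
    using K(2) by (rule closedin_subset)
  show "indecomposable_continuum (subtopology X K)"
    unfolding indecomposable_continuum_def
  proof (intro conjI notI)
    show "continuum (subtopology X K)"
      using continuum_subtopology[OF X K(2,3,1)] .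
    assume "\<exists>A B. proper_subcontinuum (subtopology X K) A \<and> proper_subcontinuum (subtopology X K) B \<and>
      topspace (subtopology X K) = A \<union> B"
    then obtain A B where
      A: "proper_subcontinuum (subtopology X K) A" and B: "proper_subcontinuum (subtopology X K) B"
      and AB: "topspace (subtopology X K) = A \<union> B"
      by blast
    have top: "topspace (subtopology X K) = K"
      using KX by auto
    have sub: "C \<subset> K" "closedin X C" "connectedin X C" if "proper_subcontinuum (subtopology X K) C" for C
    proof -
      show "C \<subset> K"
        using that unfolding proper_subcontinuum_def top by simp
      then have "subtopology (subtopology X K) C = subtopology X C"
        by (simp add: subtopology_subtopology Int_absorb1 less_imp_le)
      then have "continuum (subtopology X C)"
        using that by (simp add: proper_subcontinuum_def)
      then have "compactin X C" "connectedin X C"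
        using \<open>C \<subset> K\<close> KX by (auto simp: continuum_def connectedin_def compactin_subspace)
      then show "closedin X C" "connectedin X C"
        using compactin_imp_closedin[OF X(2)] by auto
    qed
    obtain a b where "a \<in> A" "a \<notin> B" "b \<in> B" "b \<notin> A"
      using sub(1)[OF A] sub(1)[OF B] AB unfolding top by blast
    then have disj: "A \<inter> B = {}"
      using IVT_imp_disjoint[OF X IVT sub(2,3)[OF A] sub(2,3)[OF B]] by blast
    moreover have "A \<noteq> {}" "B \<noteq> {}"
      using \<open>a \<in> A\<close> \<open>b \<in> B\<close> by auto
    ultimately show False
      using K(3) sub(2)[OF A] sub(2)[OF B] AB unfolding top connectedin_closedin by blast
  qed
qed

theorem mainTheorem1:
  fixes X :: "'a topology"
  assumes "compact_space X" and "Hausdorff_space X" and "F_space X"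
  shows "hereditarily_indecomposable X \<longleftrightarrow> IVT_completely_factored X"
  using assms hereditarily_indecomposable_imp_IVT IVT_imp_hereditarily_indecomposable by blast

end
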